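(* Let $G$ be a countable group (not necessarily amenable), and let $(X, \mathcal{B}, \mu, (T_g)_{g\in G})$ be a free measure preserving action of $G$ on a standard probability space. Then it has a topologically free model on a $0$-dimensional compact space. That is, there exist a $0$-dimensional compact metrizable space $Y$, an action $(S_g)_{g\in G}$ of $G$ on $Y$ by homeomorphisms such that $S_g y \neq y$ for every $y \in Y$ and every $g \in G$ with $g \neq e$, and a $G$-invariant Borel probability measure $\nu$ on $Y$ such that $(Y, \nu, (S_g)_{g\in G})$ is measure-theoretically isomorphic to $(X, \mathcal{B}, \mu, (T_g)_{g\in G})$.
   Context: The group $G$ is discrete, with identity element $e$. A measure preserving action $(X,\mathcal{B},\mu,(T_g)_{g\in G})$ on a standard probability space is free if $\mu(\{x \in X : T_g x = x\}) = 0$ for every $g \neq e$. A compact metrizable space is $0$-dimensional if its topology has a base of clopen sets. Two measure preserving actions of $G$ on probability spaces are (measure-theoretically) isomorphic if there is a bimeasurable bijection between $G$-invariant measurable subsets of full measure that carries one measure to the other and intertwines the actions. In this terminology "topologically free" means that every point has trivial stabilizer (all orbits are free). *)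

theory Defs
  imports "HOL-Probability.Probability" "HOL-Algebra.Group_Action"
begin

definition borel_of :: "'a topology \<Rightarrow> 'a measure" where
  "borel_of Y = sigma (topspace Y) {U. openin Y U}"

text \<open>A standard probability space is a probability measure on a standard Borel space. The
  \<^typ>\<open>'a measure\<close> carries an arbitrary carrier \<^term>\<open>space M\<close>, so the Polish
  topology is an abstract one on that carrier rather than an instance of \<^class>\<open>polish_space\<close>.
  The \<open>\<sigma>\<close>-algebra is the Borel one, not its completion.\<close>

definition standard_borel :: "'a measure \<Rightarrow> bool" where
  "standard_borel M \<longleftrightarrow>
     (\<exists>Y. topspace Y = space M \<and> completely_metrizable_space Y \<and> second_countable Y \<and>
          sets M = sets (borel_of Y))"

definition standard_prob_space :: "'a measure \<Rightarrow> bool" where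
  "standard_prob_space M \<longleftrightarrow> prob_space M \<and> standard_borel M"

text \<open>\<^const>\<open>group_action\<close> makes each \<^term>\<open>T g\<close> a bijection of the space which is
  \<^const>\<open>undefined\<close> outside it, with \<open>T (g \<otimes> h) = T g \<circ> T h\<close> on the space.\<close>

definition mp_action :: "('g, 'b) monoid_scheme \<Rightarrow> 'a measure \<Rightarrow> ('g \<Rightarrow> 'a \<Rightarrow> 'a) \<Rightarrow> bool" where
  "mp_action G M T \<longleftrightarrow>
     group_action G (space M) T \<and>
     (\<forall>g\<in>carrier G. T g \<in> M \<rightarrow>\<^sub>M M \<and> distr M M (T g) = M)"

definition free_action :: "('g, 'b) monoid_scheme \<Rightarrow> 'a measure \<Rightarrow> ('g \<Rightarrow> 'a \<Rightarrow> 'a) \<Rightarrow> bool" where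
  "free_action G M T \<longleftrightarrow>
     (\<forall>g\<in>carrier G. g \<noteq> \<one>\<^bsub>G\<^esub> \<longrightarrow> {x \<in> space M. T g x = x} \<in> null_sets M)"

definition zero_dimensional :: "'a topology \<Rightarrow> bool" where
  "zero_dimensional Y \<longleftrightarrow>
     (\<exists>\<B>. (\<forall>C\<in>\<B>. openin Y C \<and> closedin Y C) \<and>
          openin Y = arbitrary union_of (\<lambda>C. C \<in> \<B>))"

definition homeo_action :: "('g, 'b) monoid_scheme \<Rightarrow> 'a topology \<Rightarrow> ('g \<Rightarrow> 'a \<Rightarrow> 'a) \<Rightarrow> bool" where
  "homeo_action G Y S \<longleftrightarrow>
     group_action G (topspace Y) S \<and> (\<forall>g\<in>carrier G. homeomorphic_map Y Y (S g))"

definition topologically_free ::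
  "('g, 'b) monoid_scheme \<Rightarrow> 'a topology \<Rightarrow> ('g \<Rightarrow> 'a \<Rightarrow> 'a) \<Rightarrow> bool" where
  "topologically_free G Y S \<longleftrightarrow>
     (\<forall>y\<in>topspace Y. \<forall>g\<in>carrier G. g \<noteq> \<one>\<^bsub>G\<^esub> \<longrightarrow> S g y \<noteq> y)"

definition isomorphic_actions ::
  "('g, 'b) monoid_scheme \<Rightarrow> 'a measure \<Rightarrow> ('g \<Rightarrow> 'a \<Rightarrow> 'a) \<Rightarrow>
    'c measure \<Rightarrow> ('g \<Rightarrow> 'c \<Rightarrow> 'c) \<Rightarrow> bool" where
  "isomorphic_actions G M T N S \<longleftrightarrow>
     (\<exists>X0 Y0 f.
        X0 \<in> sets M \<and> emeasure M X0 = 1 \<and> (\<forall>g\<in>carrier G. T g ` X0 = X0) \<and>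
        Y0 \<in> sets N \<and> emeasure N Y0 = 1 \<and> (\<forall>g\<in>carrier G. S g ` Y0 = Y0) \<and>
        bij_betw f X0 Y0 \<and>
        f \<in> restrict_space M X0 \<rightarrow>\<^sub>M restrict_space N Y0 \<and>
        inv_into X0 f \<in> restrict_space N Y0 \<rightarrow>\<^sub>M restrict_space M X0 \<and>
        distr (restrict_space M X0) (restrict_space N Y0) f = restrict_space N Y0 \<and>
        (\<forall>g\<in>carrier G. \<forall>x\<in>X0. f (T g x) = S g (f x)))"

end

theory Submission
  imports Defs
begin

text \<open>Discard the null set of points with nontrivial stabilizer. A Polish space is coded by the
  rational balls around a dense sequence, which embeds it in a Cantor space with Borel image, so
  that the \<open>\<sigma>\<close>-algebra consists of the preimages of Borel sets. For each \<open>g \<noteq> \<one>\<close> there is a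
  measurable set \<open>A\<close> disjoint from its translate by \<open>g\<close> such that \<open>A\<close> and its translates by \<open>g\<close>
  and \<open>inv g\<close> cover the space. Record, for every group element \<open>h\<close>, the code of \<open>T (inv h) x\<close> and
  which of the sets \<open>A\<close> it lies in. This is an equivariant injection into a shift space over \<open>G\<close>.
  The two properties of the sets \<open>A\<close> only involve finitely many coordinates at a time, so the
  sequences that satisfy them form a closed shift-invariant set, and on this set the shift has no
  fixed points.\<close>

section \<open>Coding a standard Borel space in a Cantor space\<close>

abbreviation cantor :: "('i \<Rightarrow> bool) measure" where
  "cantor \<equiv> PiM UNIV (\<lambda>_. count_space UNIV)"

lemma measurable_cantor_iff:
  "f \<in> M \<rightarrow>\<^sub>M cantor \<longleftrightarrow> (\<forall>i. {x \<in> space M. f x i} \<in> sets M)"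
proof
  assume f: "f \<in> M \<rightarrow>\<^sub>M cantor"
  have "Measurable.pred M (\<lambda>x. f x i)" for i
    using measurable_compose[OF f measurable_component_singleton[of i UNIV]] by simp
  then show "\<forall>i. {x \<in> space M. f x i} \<in> sets M"
    by (simp add: pred_def)
next
  assume "\<forall>i. {x \<in> space M. f x i} \<in> sets M"
  then have "(\<lambda>x. f x i) \<in> M \<rightarrow>\<^sub>M count_space UNIV" for i
    by (simp flip: pred_def)
  then show "f \<in> M \<rightarrow>\<^sub>M cantor"
    by (intro measurable_PiM_single'[where f="\<lambda>i x. f x i", simplified]) simp_all
qed

lemma space_cantor: "space cantor = UNIV"
  by (simp add: space_PiM)

text \<open>The three conditions make \<open>\<psi>\<close> a Borel isomorphism onto a Borel subset
  of Cantor space: the description of \<open>sets M\<close> as exactly the preimages gives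
  measurability of \<open>\<psi>\<close> and of its inverse at once.\<close>

definition borel_encoding :: "'a measure \<Rightarrow> ('a \<Rightarrow> 'i \<Rightarrow> bool) \<Rightarrow> bool" where
  "borel_encoding M \<psi> \<longleftrightarrow>
     inj_on \<psi> (space M) \<and> \<psi> ` space M \<in> sets cantor \<and>
     sets M = {\<psi> -` C \<inter> space M | C. C \<in> sets cantor}"

text \<open>Allows the points with nontrivial stabilizer to be removed later without finding a new
  Polish topology for the remaining set.\<close>

lemma borel_encoding_restrict_space:
  assumes "borel_encoding M \<psi>" and A: "A \<in> sets M"
  shows "borel_encoding (restrict_space M A) \<psi>"
proof -
  have inj: "inj_on \<psi> (space M)" and im: "\<psi> ` space M \<in> sets cantor"
    and sets: "sets M = {\<psi> -` C \<inter> space M | C. C \<in> sets cantor}"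
    using assms(1) unfolding borel_encoding_def by blast+
  have sub: "A \<subseteq> space M"
    using A by (rule sets.sets_into_space)
  then have sp: "space (restrict_space M A) = A"
    by (auto simp: space_restrict_space)
  obtain C where C: "C \<in> sets cantor" "A = \<psi> -` C \<inter> space M"
    using A unfolding sets by blast
  have "\<psi> ` A = C \<inter> \<psi> ` space M"
    by (auto simp: C(2))
  moreover have "sets (restrict_space M A) = {\<psi> -` C \<inter> A | C. C \<in> sets cantor}"
  proof -
    have "sets (restrict_space M A) = (\<inter>) A ` {\<psi> -` C \<inter> space M | C. C \<in> sets cantor}"
      unfolding sets_restrict_space sets by (rule refl)
    also have "\<dots> = {\<psi> -` C \<inter> A | C. C \<in> sets cantor}"
      unfolding Setcompr_eq_image image_image
      by (rule image_cong) (use sub in blast)+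
    finally show ?thesis .
  qed
  ultimately show ?thesis
    using C(1) im inj_on_subset[OF inj sub] unfolding borel_encoding_def sp by simp
qed

text \<open>With \<open>q < r / 2\<close> and a centre within \<open>q\<close> of \<open>x\<close>,
  any two points of the ball are less than \<open>r\<close> apart. This serves injectivity of the
  code as well as the writing of open sets as countable unions of coded balls.\<close>

lemma (in Metric_space) separating_rational_balls:
  fixes a :: "nat \<Rightarrow> 'a"
  assumes dense: "\<And>x r. x \<in> M \<Longrightarrow> 0 < r \<Longrightarrow> \<exists>i. d x (a i) < r"
    and a: "range a \<subseteq> M" and x: "x \<in> M" and r: "0 < r"
  obtains i q where "d x (a i) < of_rat q" "\<And>z. z \<in> M \<Longrightarrow> d z (a i) < of_rat q \<Longrightarrow> d x z < r"
proof -
  obtain q where q: "0 < real_of_rat q" "of_rat q < r / 2"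
    using of_rat_dense[of 0 "r / 2"] r by auto
  obtain i where i: "d x (a i) < of_rat q"
    using dense[OF x q(1)] by blast
  have "d x z < r" if "z \<in> M" "d z (a i) < of_rat q" for z
  proof -
    have "d x z \<le> d x (a i) + d (a i) z"
      using triangle x that(1) a by blast
    then show ?thesis
      using i that q(2) commute[of z "a i"] by linarith
  qed
  then show thesis
    using i that by blast
qed

text \<open>A point is coded by the rational balls around a dense sequence \<open>a\<close> that contain it. The four
  conditions make the codes a Borel set because a code satisfying them prescribes a Cauchy
  sequence of centres, whose limit has that code.\<close>

lemma (in Metric_space) range_rational_ball_code:
  fixes a :: "nat \<Rightarrow> 'a"
  assumes complete: mcomplete
    and dense: "\<And>x r. x \<in> M \<Longrightarrow> 0 < r \<Longrightarrow> \<exists>i. d x (a i) < r"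
    and a: "range a \<subseteq> M"
  shows "(\<lambda>x (i, q). d x (a i) < of_rat q) ` M = {y.
    (\<forall>k. \<exists>i. y (i, 1 / of_nat (Suc k))) \<and>
    (\<forall>i j p q. y (i, p) \<and> y (j, q) \<longrightarrow> d (a i) (a j) < of_rat p + of_rat q) \<and>
    (\<forall>i j p q. y (i, p) \<and> d (a i) (a j) + of_rat p \<le> of_rat q \<longrightarrow> y (j, q)) \<and>
    (\<forall>i q. y (i, q) \<longrightarrow> (\<exists>p<q. y (i, p)))}" (is "?\<psi> ` M = ?R")
proof (intro Set.set_eqI iffI)
  fix y assume "y \<in> ?\<psi> ` M"
  then obtain x where x: "x \<in> M" and y: "y = ?\<psi> x" by blast
  have aM: "a i \<in> M" for i using a by blast
  have "\<exists>i. y (i, 1 / of_nat (Suc k))" for k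
    using dense[OF x, of "1 / real (Suc k)"] by (simp add: y of_rat_divide of_rat_add)
  moreover have "d (a i) (a j) < of_rat p + of_rat q" if "y (i, p) \<and> y (j, q)" for i j p q
    using that triangle[of "a i" x "a j"] aM x by (simp add: y commute)
  moreover have "y (j, q)" if "y (i, p) \<and> d (a i) (a j) + of_rat p \<le> of_rat q" for i j p q
    using that triangle[of x "a i" "a j"] aM x by (simp add: y)
  moreover have "\<exists>p<q. y (i, p)" if "y (i, q)" for i q
    using that of_rat_dense[of "d x (a i)" "of_rat q"] by (auto simp: y of_rat_less)
  ultimately show "y \<in> ?R" by blast
next
  fix y assume "y \<in> ?R"
  then have small: "\<And>k. \<exists>i. y (i, 1 / of_nat (Suc k))"
    and near: "\<And>i j p q. y (i, p) \<Longrightarrow> y (j, q) \<Longrightarrow> d (a i) (a j) < of_rat p + of_rat q"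
    and up: "\<And>i j p q. y (i, p) \<Longrightarrow> d (a i) (a j) + of_rat p \<le> of_rat q \<Longrightarrow> y (j, q)"
    and op: "\<And>i q. y (i, q) \<Longrightarrow> \<exists>p<q. y (i, p)"
    by blast+
  have aM: "a i \<in> M" for i using a by blast
  obtain c where c: "\<And>k. y (c k, 1 / of_nat (Suc k))"
    using small by metis
  define e where "e k = 1 / real (Suc k)" for k
  have e: "of_rat (1 / of_nat (Suc k)) = e k" for k
    by (simp add: e_def of_rat_divide of_rat_add)
  have e_lim: "\<exists>K. \<forall>k\<ge>K. e k < \<epsilon>" if "0 < \<epsilon>" for \<epsilon>
    using order_tendstoD(2)[OF LIMSEQ_inverse_real_of_nat that]
    by (simp add: e_def eventually_sequentially inverse_eq_divide)
  have "MCauchy (\<lambda>k. a (c k))"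
    unfolding MCauchy_def
  proof (intro conjI allI impI)
    fix \<epsilon> :: real assume "0 < \<epsilon>"
    then obtain K where K: "\<forall>k\<ge>K. e k < \<epsilon> / 2"
      using e_lim[of "\<epsilon> / 2"] by auto
    have "d (a (c k)) (a (c l)) < \<epsilon>" if "K \<le> k" "K \<le> l" for k l
      using near[OF c[of k] c[of l]] K that unfolding e
      by (smt (verit) field_sum_of_halves)
    then show "\<exists>K. \<forall>k l. K \<le> k \<longrightarrow> K \<le> l \<longrightarrow> d (a (c k)) (a (c l)) < \<epsilon>"
      by blast
  qed (use aM in auto)
  then obtain x where lim: "limitin mtopology (\<lambda>k. a (c k)) x sequentially"
    using complete mcomplete_def by blast
  then have x: "x \<in> M"
    by (simp add: limitin_mspace)
  have d_lim: "\<exists>k. d x (a (c k)) < \<epsilon> \<and> e k < \<epsilon>" if "0 < \<epsilon>" for \<epsilon>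
  proof -
    obtain K where "\<forall>k\<ge>K. d (a (c k)) x < \<epsilon>"
      using lim \<open>0 < \<epsilon>\<close> unfolding limit_metric_sequentially by blast
    moreover obtain L where "\<forall>k\<ge>L. e k < \<epsilon>"
      using e_lim[OF \<open>0 < \<epsilon>\<close>] by blast
    ultimately show ?thesis
      by (intro exI[of _ "max K L"]) (simp add: commute)
  qed
  have "y (j, q) \<longleftrightarrow> d x (a j) < of_rat q" for j q
  proof
    assume "y (j, q)"
    \<comment> \<open>The limit of the centres only satisfies a non-strict bound, so the radius is
      first shrunk to \<open>p < q\<close>.\<close>
    then obtain p where p: "p < q" "y (j, p)"
      using op by blast
    have "d x (a j) \<le> of_rat p + \<epsilon>" if "0 < \<epsilon>" for \<epsilon>
    proof -
      obtain k where k: "d x (a (c k)) < \<epsilon> / 2" "e k < \<epsilon> / 2"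
        using d_lim[of "\<epsilon> / 2"] \<open>0 < \<epsilon>\<close> by fastforce
      have "d (a (c k)) (a j) < e k + of_rat p"
        using near[OF c[of k] p(2)] unfolding e .
      then show ?thesis
        using k triangle[OF x aM[of "c k"] aM[of j]] by linarith
    qed
    then have "d x (a j) \<le> of_rat p"
      by (rule field_le_epsilon)
    then show "d x (a j) < of_rat q"
      using p(1) by (meson le_less_trans of_rat_less)
  next
    assume less: "d x (a j) < of_rat q"
    \<comment> \<open>Half of the slack: one half absorbs the distance from \<open>x\<close> to the
      centre \<open>a (c k)\<close>, the other its radius \<open>e k\<close>, so that condition
      \<open>up\<close> applies.\<close>
    define \<epsilon> where "\<epsilon> = (of_rat q - d x (a j)) / 2"
    obtain k where k: "d x (a (c k)) < \<epsilon>" "e k < \<epsilon>"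
      using d_lim[of \<epsilon>] less unfolding \<epsilon>_def by fastforce
    have "d (a (c k)) (a j) + e k \<le> of_rat q"
      using k triangle[OF aM[of "c k"] x aM[of j]] commute[of x "a (c k)"]
      unfolding \<epsilon>_def by argo
    then show "y (j, q)"
      using up[OF c[of k], of j q] unfolding e by simp
  qed
  then have "y = ?\<psi> x" by auto
  then show "y \<in> ?\<psi> ` M"
    using x by blast
qed

text \<open>Separability makes countably many balls sufficient and completeness makes the set of
  codes Borel. Nonemptiness allows a dense set to be enumerated by a total sequence.\<close>

lemma standard_borel_encoding:
  assumes "standard_borel M" and ne: "space M \<noteq> {}"
  obtains \<psi> :: "'a \<Rightarrow> nat \<times> rat \<Rightarrow> bool" where "borel_encoding M \<psi>"
proof -
  obtain P where P: "topspace P = space M" "completely_metrizable_space P" "second_countable P"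
    "sets M = sets (borel_of P)"
    using assms unfolding standard_borel_def by blast
  then obtain m d where met: "Metric_space m d" and complete: "Metric_space.mcomplete m d"
    and Pm: "P = Metric_space.mtopology m d"
    unfolding completely_metrizable_space_def by blast
  interpret Metric_space m d by (rule met)
  have m: "m = space M"
    using P(1) by (simp add: Pm)
  have sets: "sets M = sigma_sets m {U. openin P U}"
    proof -
    have "{U. openin P U} \<subseteq> Pow m"
      using openin_subset[of P] by (auto simp: P(1) m)
    then show ?thesis
      by (simp add: P(4) borel_of_def sets_measure_of P(1) flip: m)
  qed
  obtain D where D: "countable D" "D \<subseteq> m" "mtopology closure_of D = m"
    using second_countable_imp_separable_space[OF P(3)] unfolding separable_space_def Pm by auto
  have "D \<noteq> {}"
    using D(3) ne m by auto
  define a where "a = from_nat_into D"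
  have ranD: "range a = D"
    by (simp add: a_def \<open>D \<noteq> {}\<close> D(1))
  then have ran: "range a \<subseteq> m"
    using D(2) by simp
  have dense: "\<exists>i. d x (a i) < r" if "x \<in> m" "0 < r" for x r
    using that D(3) ranD unfolding metric_closure_of by (auto simp: in_mball set_eq_iff) (metis rangeE)
  note balls = separating_rational_balls[OF dense ran]
  define \<psi> where "\<psi> = (\<lambda>x (i, q). d x (a i) < of_rat q)"
  have "inj_on \<psi> m"
  proof (rule inj_onI, rule ccontr)
    fix x y assume xy: "x \<in> m" "y \<in> m" "\<psi> x = \<psi> y" "x \<noteq> y"
    obtain i q where "d x (a i) < of_rat q"
      "\<And>z. z \<in> m \<Longrightarrow> d z (a i) < of_rat q \<Longrightarrow> d x z < d x y"
      using balls[of x "d x y"] xy by auto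
    moreover have "\<psi> x (i, q) = \<psi> y (i, q)"
      using xy by simp
    ultimately show False
      using xy(2) by (auto simp: \<psi>_def)
  qed
  moreover have "\<psi> ` m \<in> sets cantor"
  proof -
    \<comment> \<open>All quantifiers range over countable sets and each instance involves at most
      two coordinates, so the conditions cut out a Borel set.\<close>
    have meas: "{y \<in> space cantor.
    (\<forall>k::nat. \<exists>i::nat. y (i, 1 / of_nat (Suc k) :: rat)) \<and>
    (\<forall>i j p q. y (i, p) \<and> y (j, q) \<longrightarrow> d (a i) (a j) < of_rat p + of_rat q) \<and>
    (\<forall>i j p q. y (i, p) \<and> d (a i) (a j) + of_rat p \<le> of_rat q \<longrightarrow> y (j, q)) \<and>
    (\<forall>i q. y (i, q) \<longrightarrow> (\<exists>p\<in>{..<q}. y (i, p)))} \<in> sets cantor"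
      by measurable
    have "\<psi> ` m = {y.
    (\<forall>k. \<exists>i. y (i, 1 / of_nat (Suc k))) \<and>
    (\<forall>i j p q. y (i, p) \<and> y (j, q) \<longrightarrow> d (a i) (a j) < of_rat p + of_rat q) \<and>
    (\<forall>i j p q. y (i, p) \<and> d (a i) (a j) + of_rat p \<le> of_rat q \<longrightarrow> y (j, q)) \<and>
    (\<forall>i q. y (i, q) \<longrightarrow> (\<exists>p<q. y (i, p)))}"
      unfolding \<psi>_def by (rule range_rational_ball_code[OF complete _ ran]) (rule dense)
    then show ?thesis
      using meas unfolding space_cantor Bex_def lessThan_iff by simp
  qed
  moreover have "sets M = {\<psi> -` C \<inter> m | C. C \<in> sets cantor}"
  proof -
    \<comment> \<open>The pulled-back \<sigma>-algebra is generated by the rational balls around the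
      \<open>a i\<close>. It contains every open set, as a countable union of such balls, and the
      balls are themselves open.\<close>
    let ?V = "vimage_algebra m \<psi> cantor"
    have V: "sets ?V = {\<psi> -` C \<inter> m | C. C \<in> sets cantor}"
      by (rule sets_vimage_algebra2) (simp add: space_cantor)
    have \<psi>V: "\<psi> \<in> ?V \<rightarrow>\<^sub>M cantor"
      by (rule measurable_vimage_algebra1) (simp add: space_cantor)
    have ball: "{x \<in> m. \<psi> x (i, q)} = mball (a i) (of_rat q)" for i q
      using rangeI[of a i, THEN subsetD[OF ran]] by (auto simp: \<psi>_def in_mball commute)
    have "U \<in> sets ?V" if "openin P U" for U
    proof -
      let ?I = "{(i, q). mball (a i) (of_rat q) \<subseteq> U}"
      have "U \<subseteq> (\<Union>(i, q)\<in>?I. mball (a i) (of_rat q))"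
      proof
        fix x assume "x \<in> U"
        then have x: "x \<in> m" and "\<exists>r>0. mball x r \<subseteq> U"
          using \<open>openin P U\<close> unfolding Pm openin_mtopology by auto
        then obtain r where r: "0 < r" "mball x r \<subseteq> U"
          by blast
        obtain i q where iq: "d x (a i) < of_rat q"
          "\<And>z. z \<in> m \<Longrightarrow> d z (a i) < of_rat q \<Longrightarrow> d x z < r"
          using balls[OF _ _ x r(1)] by metis
        then have "mball (a i) (of_rat q) \<subseteq> mball x r"
          using x by (auto simp: commute)
        moreover have "x \<in> mball (a i) (of_rat q)"
          using iq(1) x rangeI[of a i, THEN subsetD[OF ran]] by (auto simp: in_mball commute)
        ultimately show "x \<in> (\<Union>(i, q)\<in>?I. mball (a i) (of_rat q))"
          using r(2) by blast
      qed
      then have U: "U = (\<Union>(i, q)\<in>?I. mball (a i) (of_rat q))"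
        by blast
      show ?thesis
        by (subst U, rule sets.countable_UN'')
          (use \<psi>V in \<open>auto simp: measurable_cantor_iff simp flip: ball\<close>)
    qed
    then have "sets M \<subseteq> sets ?V"
      unfolding sets using sets.sigma_sets_subset[of "{U. openin P U}" ?V] by auto
    moreover have "mball (a i) (of_rat q) \<in> sets M" for i q
      unfolding sets by (rule sigma_sets.Basic) (simp add: Pm)
    then have "\<psi> \<in> M \<rightarrow>\<^sub>M cantor"
      by (simp add: measurable_cantor_iff flip: m) (simp add: ball)
    then have "sets ?V \<subseteq> sets M"
      unfolding V by (auto simp: m dest: measurable_sets)
    ultimately show ?thesis
      using V by blast
  qed
  ultimately show thesis
    unfolding m by (intro that) (auto simp only: borel_encoding_def)
qed

section \<open>Marker sets\<close>

text \<open>The set \<open>A\<close> is built greedily: stage \<open>n\<close> adds those points of \<open>B n\<close> that have no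
  neighbour in the graph of \<open>f\<close> chosen before.\<close>

lemma exists_marker_set:
  fixes B :: "nat \<Rightarrow> 'a set"
  assumes f [measurable]: "f \<in> M \<rightarrow>\<^sub>M M" and f' [measurable]: "f' \<in> M \<rightarrow>\<^sub>M M"
    and inv: "\<And>x. x \<in> space M \<Longrightarrow> f' (f x) = x"
    and B [measurable]: "\<And>n. B n \<in> sets M" and cover: "space M \<subseteq> (\<Union>n. B n)"
    and indep: "\<And>n x. x \<in> B n \<Longrightarrow> f x \<notin> B n"
  obtains A where "A \<in> sets M" "\<And>x. x \<in> A \<Longrightarrow> f x \<notin> A"
    "\<And>x. x \<in> space M \<Longrightarrow> x \<in> A \<or> f x \<in> A \<or> f' x \<in> A"
proof -
  define S where "S = rec_nat {}
    (\<lambda>n A. A \<union> {x \<in> space M. x \<in> B n \<and> f x \<notin> A \<and> f' x \<notin> A})"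
  have S_0: "S 0 = {}"
    and S_Suc: "S (Suc n) = S n \<union> {x \<in> space M. x \<in> B n \<and> f x \<notin> S n \<and> f' x \<notin> S n}" for n
    by (simp_all add: S_def)
  have S_meas: "S n \<in> sets M" for n
  proof (induction n)
    case (Suc n)
    note [measurable] = Suc
    show ?case unfolding S_Suc by measurable
  qed (simp add: S_0)
  \<comment> \<open>If \<open>x\<close> is older than \<open>f x\<close>, then \<open>f x\<close>
    was rejected because \<open>f' (f x) = x\<close> was already chosen. If \<open>x\<close> is
    newer, \<open>f x\<close> would have blocked it. Two points added at the same stage both lie in
    \<open>B n\<close>.\<close>
  have S_indep: "f x \<notin> S n" if "x \<in> S n" for n x
    using that
  proof (induction n)
    case (Suc n)
    have "x \<in> space M"
      using Suc.prems S_meas sets.sets_into_space by blast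
    then show ?case
      using Suc indep[of x n] inv[of x] by (auto simp: S_Suc)
  qed (simp add: S_0)
  have mono: "S m \<subseteq> S n" if "m \<le> n" for m n
    by (rule lift_Suc_mono_le[OF _ that]) (auto simp: S_Suc)
  show thesis
  proof
    show "(\<Union>n. S n) \<in> sets M"
      using S_meas by blast
    show "f x \<notin> (\<Union>n. S n)" if "x \<in> (\<Union>n. S n)" for x
    proof
      assume "f x \<in> (\<Union>n. S n)"
      with that obtain i j where "x \<in> S i" "f x \<in> S j"
        by blast
      then have "x \<in> S (max i j)" "f x \<in> S (max i j)"
        using mono[of i "max i j"] mono[of j "max i j"] by auto
      then show False
        using S_indep by blast
    qed
    show "x \<in> (\<Union>n. S n) \<or> f x \<in> (\<Union>n. S n) \<or> f' x \<in> (\<Union>n. S n)" if "x \<in> space M" for x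
    proof -
      from cover \<open>x \<in> space M\<close> obtain n where "x \<in> B n"
        by blast
      \<comment> \<open>A point of \<open>B n\<close> is rejected at stage \<open>n\<close> only
        because of a neighbour chosen earlier.\<close>
      then have "x \<in> S (Suc n) \<or> f x \<in> S n \<or> f' x \<in> S n"
        using that by (auto simp: S_Suc)
      then show ?thesis by blast
    qed
  qed
qed

section \<open>Topology of the Cantor space\<close>

text \<open>Needed to identify the product \<sigma>-algebra on a countable power of
  \<open>bool\<close> with the Borel \<sigma>-algebra of the product topology.\<close>

instance bool :: second_countable_topology
proof
  have "countable (UNIV :: bool set set)" by simp
  moreover have "open = generate_topology (UNIV :: bool set set)"
    by (simp add: fun_eq_iff Topological_Spaces.open_discrete generate_topology.Basis)
  ultimately show "\<exists>B::bool set set. countable B \<and> open = generate_topology B"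
    by blast
qed

text \<open>Links measurability, which is checked coordinate by coordinate, with the topology of the
  model. The index type has to be countable here, which is one reason for numbering the coordinates
  of the shift space by naturals.\<close>

lemma sets_cantor_eq_borel: "sets (cantor :: ('i :: countable \<Rightarrow> bool) measure) = sets borel"
proof -
  have "sets (cantor :: ('i \<Rightarrow> bool) measure) = sets (PiM UNIV (\<lambda>_::'i. borel :: bool measure))"
    by (intro sets_PiM_cong) (simp_all add: sets_borel_eq_count_space)
  then show ?thesis
    using sets_PiM_equal_borel by simp
qed

lemma sets_borel_of_top_of_set:
  "sets (borel_of (top_of_set K)) = sets (restrict_space borel K)"
proof -
  have "sets (borel_of (top_of_set K)) = sigma_sets K {U. openin (top_of_set K) U}"
    unfolding borel_of_def topspace_euclidean_subtopology
    by (rule sets_measure_of) (auto dest: openin_imp_subset)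
  also have "{U. openin (top_of_set K) U} = (\<lambda>U. K \<inter> U) ` {U. open U}"
    by (auto simp: openin_open)
  also have "sigma_sets K \<dots> = sets (restrict_space borel K)"
    using sigma_sets_vimage_commute[of "\<lambda>x. x" K UNIV "{U. open U}"]
    unfolding Setcompr_eq_image sets_restrict_space sets_borel vimage_ident
    by (simp add: Int_commute)
  finally show ?thesis .
qed

text \<open>A basic open box restricts finitely many coordinates. It is also closed, being an
  intersection of coordinate preimages of subsets of the discrete space \<open>bool\<close>.\<close>

lemma zero_dimensional_top_of_set:
  "zero_dimensional (top_of_set (K :: ('i \<Rightarrow> bool) set))"
proof -
  let ?B = "{C. openin (top_of_set K) C \<and> closedin (top_of_set K) C}"
  have "\<exists>V\<in>?B. x \<in> V \<and> V \<subseteq> U" if "openin (top_of_set K) U" "x \<in> U" for U x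
  proof -
    from that(1) obtain W where W: "open W" "U = K \<inter> W"
      unfolding openin_open by blast
    have "openin (product_topology (\<lambda>_::'i. euclidean :: bool topology) UNIV) W" "x \<in> W"
      using W that(2) by (simp_all add: euclidean_product_topology)
    from product_topology_open_contains_basis[OF this]
    obtain X where X: "x \<in> Pi\<^sub>E UNIV X" "Pi\<^sub>E UNIV X \<subseteq> W" "finite {i. X i \<noteq> UNIV}"
      by auto
    have "open (Pi\<^sub>E UNIV X)"
      using X(3) by (intro open_PiE) (auto simp: Topological_Spaces.open_discrete)
    moreover have "closed ((\<lambda>f. f i) -` X i :: ('i \<Rightarrow> bool) set)" for i
      by (intro closed_vimage continuous_on_product_coordinates)
        (simp add: closed_def Topological_Spaces.open_discrete)
    then have "closed (\<Inter>i. (\<lambda>f. f i) -` X i :: ('i \<Rightarrow> bool) set)"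
      by blast
    then have "closed (Pi\<^sub>E UNIV X)"
      by (simp add: PiE_UNIV_domain Pi_def vimage_def INTER_eq)
    ultimately have "K \<inter> Pi\<^sub>E UNIV X \<in> ?B"
      by (auto simp: openin_open closedin_closed)
    then show ?thesis
      using X W that(2) by (intro bexI[of _ "K \<inter> Pi\<^sub>E UNIV X"]) auto
  qed
  then have "openin (top_of_set K) = arbitrary union_of (\<lambda>C. C \<in> ?B)"
    by (subst openin_topology_base_unique) auto
  then show ?thesis
    unfolding zero_dimensional_def by (intro exI[of _ ?B]) simp
qed

lemma compact_cantor: "compact (UNIV :: ('i \<Rightarrow> bool) set)"
proof -
  have "compact_space (euclidean :: bool topology)"
    by (simp add: compact_space_def finite_imp_compact)
  then have "compact_space (product_topology (\<lambda>_::'i. euclidean :: bool topology) UNIV)"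
    by (simp add: compact_space_product_topology)
  then show ?thesis
    by (simp add: euclidean_product_topology compact_space_def)
qed

lemma metrizable_cantor: "metrizable_space (euclidean :: ('i :: countable \<Rightarrow> bool) topology)"
proof -
  have "(euclidean :: bool topology) = discrete_topology UNIV"
    by (simp add: topology_eq Topological_Spaces.open_discrete del: open_openin flip: open_openin)
  then have "metrizable_space (euclidean :: bool topology)"
    by (metis metrizable_space_discrete_topology)
  then have "metrizable_space (product_topology (\<lambda>_::'i. euclidean :: bool topology) UNIV)"
    by (simp add: metrizable_space_product_topology)
  then show ?thesis
    by (simp add: euclidean_product_topology)
qed

section \<open>Actions\<close>

text \<open>The inverse of \<open>S g\<close> on \<open>K\<close> is \<open>S (inv g)\<close>, which
  gives bijectivity. The restriction is there because \<open>Bij K\<close> consists of maps that are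
  extensional on \<open>K\<close>.\<close>

lemma group_action_restrictI:
  assumes "group G"
    and maps: "\<And>g x. g \<in> carrier G \<Longrightarrow> x \<in> K \<Longrightarrow> S g x \<in> K"
    and one: "\<And>x. x \<in> K \<Longrightarrow> S \<one>\<^bsub>G\<^esub> x = x"
    and mult: "\<And>g h x. g \<in> carrier G \<Longrightarrow> h \<in> carrier G \<Longrightarrow> x \<in> K \<Longrightarrow>
      S (g \<otimes>\<^bsub>G\<^esub> h) x = S g (S h x)"
  shows "group_action G K (\<lambda>g. restrict (S g) K)"
proof -
  interpret group G by fact
  have "bij_betw (S g) K K" if g: "g \<in> carrier G" for g
  proof (rule bij_betw_byWitness[where f' = "S (inv\<^bsub>G\<^esub> g)"])
    show "\<forall>x\<in>K. S (inv\<^bsub>G\<^esub> g) (S g x) = x" "\<forall>x\<in>K. S g (S (inv\<^bsub>G\<^esub> g) x) = x"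
      using g by (simp_all add: one flip: mult)
  qed (use g maps in auto)
  then have "restrict (S g) K \<in> Bij K" if "g \<in> carrier G" for g
    using that by (simp add: Bij_def)
  then have "(\<lambda>g. restrict (S g) K) \<in> hom G (BijGroup K)"
    by (auto simp: hom_def BijGroup_def compose_def mult maps fun_eq_iff restrict_def)
  then show ?thesis
    by (simp add: group_action_def group_hom_def group_hom_axioms_def group_BijGroup is_group)
qed

text \<open>Reduces the theorem to the free part of the space: an isomorphism only concerns some
  invariant set of measure 1, and subsets of \<open>X\<close> have the same measure in
  \<open>M\<close> and in its restriction.\<close>

lemma isomorphic_actions_restrict_space:
  assumes iso: "isomorphic_actions G (restrict_space M X) T N S" and X: "X \<in> sets M"
  shows "isomorphic_actions G M T N S"
proof -
  obtain X0 Y0 f where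
    X0: "X0 \<in> sets (restrict_space M X)" "emeasure (restrict_space M X) X0 = 1"
      "\<forall>g\<in>carrier G. T g ` X0 = X0"
    and Y0: "Y0 \<in> sets N" "emeasure N Y0 = 1" "\<forall>g\<in>carrier G. S g ` Y0 = Y0"
    and f: "bij_betw f X0 Y0"
      "f \<in> restrict_space (restrict_space M X) X0 \<rightarrow>\<^sub>M restrict_space N Y0"
      "inv_into X0 f \<in> restrict_space N Y0 \<rightarrow>\<^sub>M restrict_space (restrict_space M X) X0"
      "distr (restrict_space (restrict_space M X) X0) (restrict_space N Y0) f = restrict_space N Y0"
      "\<forall>g\<in>carrier G. \<forall>x\<in>X0. f (T g x) = S g (f x)"
    using iso unfolding isomorphic_actions_def by blast
  have X0M: "X0 \<in> sets M" "X0 \<subseteq> X"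
    using X0(1) X by (simp_all add: sets_restrict_space_iff)
  have "restrict_space (restrict_space M X) X0 = restrict_space M X0"
    using X0M X by (subst restrict_restrict_space) (auto simp: Int_absorb1)
  moreover have "emeasure M X0 = 1"
    using X0(2) X X0M by (simp add: emeasure_restrict_space)
  ultimately show ?thesis
    unfolding isomorphic_actions_def using X0M X0(3) Y0 f by metis
qed

section \<open>A free model of a free Borel action\<close>

text \<open>Freeness holds at every point here, since the space will be the free part. The action
  laws are stated pointwise because the original maps \<open>T g\<close> are kept when the space
  shrinks, and they are not extensional on the smaller set.\<close>

locale free_borel_action = group G for G (structure) +
  fixes M :: "'a measure" and T :: "'g \<Rightarrow> 'a \<Rightarrow> 'a" and \<psi> :: "'a \<Rightarrow> nat \<times> rat \<Rightarrow> bool"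
  assumes countable_group: "countable (carrier G)"
    and prob_space_M: "prob_space M"
    and encoding: "borel_encoding M \<psi>"
    and T_measurable: "g \<in> carrier G \<Longrightarrow> T g \<in> M \<rightarrow>\<^sub>M M"
    and T_mult: "g \<in> carrier G \<Longrightarrow> h \<in> carrier G \<Longrightarrow> x \<in> space M \<Longrightarrow> T (g \<otimes> h) x = T g (T h x)"
    and T_one: "x \<in> space M \<Longrightarrow> T \<one> x = x"
    and T_preserves: "g \<in> carrier G \<Longrightarrow> distr M M (T g) = M"
    and T_free: "g \<in> carrier G \<Longrightarrow> g \<noteq> \<one> \<Longrightarrow> x \<in> space M \<Longrightarrow> T g x \<noteq> x"
begin

section \<open>Marker sets of the action\<close>

lemma T_space: "g \<in> carrier G \<Longrightarrow> x \<in> space M \<Longrightarrow> T g x \<in> space M"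
  using T_measurable by (rule measurable_space)

lemma inj_encoding: "inj_on \<psi> (space M)"
  and range_encoding: "\<psi> ` space M \<in> sets cantor"
  and sets_encoding: "sets M = {\<psi> -` C \<inter> space M | C. C \<in> sets cantor}"
  using encoding unfolding borel_encoding_def by blast+

lemma encoding_measurable: "\<psi> \<in> M \<rightarrow>\<^sub>M cantor"
proof (rule measurableI)
  show "\<psi> -` C \<inter> space M \<in> sets M" if "C \<in> sets cantor" for C
    unfolding sets_encoding using that by blast
qed (simp add: space_cantor)

text \<open>The set of points where \<open>\<psi>\<close> has value \<open>b\<close> at coordinate
  \<open>i\<close> while the translate by \<open>inv g\<close> has the opposite value is disjoint
  from its translate. As \<open>inv g\<close> moves every point and \<open>\<psi>\<close> is
  injective, these countably many sets cover the space, so the greedy construction applies.\<close>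

lemma marker_exists:
  assumes g: "g \<in> carrier G" "g \<noteq> \<one>"
  shows "\<exists>A. A \<in> sets M \<and> (\<forall>x\<in>A. T (inv g) x \<notin> A) \<and>
    (\<forall>x\<in>space M. x \<in> A \<or> T (inv g) x \<in> A \<or> T g x \<in> A)"
proof -
  define f where "f = T (inv g)"
  have f: "f \<in> M \<rightarrow>\<^sub>M M" "T g \<in> M \<rightarrow>\<^sub>M M"
    using g T_measurable by (simp_all add: f_def)
  define B where "B n = (case from_nat n of (i, b) \<Rightarrow>
    {x \<in> space M. \<psi> x i = b \<and> \<psi> (f x) i = (\<not> b)})" for n
  have [measurable]: "Measurable.pred M (\<lambda>x. \<psi> x i)" "Measurable.pred M (\<lambda>x. \<psi> (f x) i)" for i
    using encoding_measurable measurable_compose[OF f(1) encoding_measurable]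
    unfolding measurable_cantor_iff pred_def by blast+
  show ?thesis
  proof (rule exists_marker_set[OF f])
    show "T g (f x) = x" if "x \<in> space M" for x
      using g that by (simp add: f_def T_one flip: T_mult)
    show "B n \<in> sets M" for n
      by (cases "from_nat n :: (nat \<times> rat) \<times> bool") (simp add: B_def)
    show "f x \<notin> B n" if "x \<in> B n" for n x
      using that by (auto simp: B_def split: prod.splits)
    show "space M \<subseteq> (\<Union>n. B n)"
    proof
      fix x assume x: "x \<in> space M"
      have "inv g \<noteq> \<one>"
        using g by simp
      then have "f x \<noteq> x"
        using T_free g(1) x by (simp add: f_def)
      then have "\<psi> (f x) \<noteq> \<psi> x"
        using inj_onD[OF inj_encoding] x measurable_space[OF f(1)] by blast
      then obtain i where "\<psi> (f x) i \<noteq> \<psi> x i"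
        by blast
      then have "x \<in> B (to_nat (i, \<psi> x i))"
        using x by (simp add: B_def)
      then show "x \<in> (\<Union>n. B n)" by blast
    qed
  qed (auto simp: f_def)
qed

text \<open>The condition \<open>g \<noteq> \<one>\<close> sits inside the choice so that
  \<open>marker \<one>\<close> is still measurable and every group element can serve as a
  label.\<close>

definition marker :: "'g \<Rightarrow> 'a set" where
  "marker g = (SOME A. A \<in> sets M \<and> (g \<noteq> \<one> \<longrightarrow> (\<forall>x\<in>A. T (inv g) x \<notin> A) \<and>
    (\<forall>x\<in>space M. x \<in> A \<or> T (inv g) x \<in> A \<or> T g x \<in> A)))"

lemma marker:
  assumes "g \<in> carrier G"
  shows marker_measurable: "marker g \<in> sets M"
    and marker_disjoint: "g \<noteq> \<one> \<Longrightarrow> x \<in> marker g \<Longrightarrow> T (inv g) x \<notin> marker g"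
    and marker_cover: "g \<noteq> \<one> \<Longrightarrow> x \<in> space M \<Longrightarrow>
      x \<in> marker g \<or> T (inv g) x \<in> marker g \<or> T g x \<in> marker g"
proof -
  have "\<exists>A. A \<in> sets M \<and> (g \<noteq> \<one> \<longrightarrow> (\<forall>x\<in>A. T (inv g) x \<notin> A) \<and>
    (\<forall>x\<in>space M. x \<in> A \<or> T (inv g) x \<in> A \<or> T g x \<in> A))"
    using marker_exists[OF assms] by blast
  from someI_ex[OF this, folded marker_def]
  show "marker g \<in> sets M" "g \<noteq> \<one> \<Longrightarrow> x \<in> marker g \<Longrightarrow> T (inv g) x \<notin> marker g"
    "g \<noteq> \<one> \<Longrightarrow> x \<in> space M \<Longrightarrow> x \<in> marker g \<or> T (inv g) x \<in> marker g \<or> T g x \<in> marker g"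
    by blast+
qed

section \<open>Coordinates of the shift space\<close>

definition label_set :: "(nat \<times> rat) + 'g \<Rightarrow> 'a set" where
  "label_set j = (case j of Inl i \<Rightarrow> {x \<in> space M. \<psi> x i} | Inr g \<Rightarrow> marker g)"

definition labels :: "((nat \<times> rat) + 'g) set" where
  "labels = UNIV <+> carrier G"

text \<open>The coordinates are pairs of a group element and a label. There are infinitely many
  labels even if \<open>G\<close> is finite, so the numbering is a bijection onto the naturals and
  the model can live in \<open>nat \<Rightarrow> bool\<close>.\<close>

definition num :: "'g \<Rightarrow> (nat \<times> rat) + 'g \<Rightarrow> nat" where
  "num h j = to_nat_on (carrier G \<times> labels) (h, j)"

definition group_part :: "nat \<Rightarrow> 'g" where
  "group_part k = fst (from_nat_into (carrier G \<times> labels) k)"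

definition label_part :: "nat \<Rightarrow> (nat \<times> rat) + 'g" where
  "label_part k = snd (from_nat_into (carrier G \<times> labels) k)"

lemma infinite_index: "infinite (carrier G \<times> labels)"
  and countable_index: "countable (carrier G \<times> labels)"
proof -
  have "infinite (UNIV :: (nat \<times> rat) set)"
    by (simp add: finite_prod)
  then have "infinite labels"
    by (simp add: labels_def finite_Plus_iff)
  then show "infinite (carrier G \<times> labels)"
    using one_closed by (auto simp: finite_cartesian_product_iff)
  show "countable (carrier G \<times> labels)"
    unfolding labels_def Plus_def using countable_group by auto
qed

lemma group_part_in [simp]: "group_part k \<in> carrier G"
  and label_part_in [simp]: "label_part k \<in> labels"
  and num_parts [simp]: "num (group_part k) (label_part k) = k"
proof -
  have "from_nat_into (carrier G \<times> labels) k \<in> carrier G \<times> labels"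
    using infinite_index by (intro from_nat_into) auto
  then show "group_part k \<in> carrier G" "label_part k \<in> labels"
    by (auto simp: group_part_def label_part_def)
  show "num (group_part k) (label_part k) = k"
    using infinite_index countable_index by (simp add: num_def group_part_def label_part_def)
qed

lemma parts_num:
  assumes "h \<in> carrier G" "j \<in> labels"
  shows "group_part (num h j) = h" "label_part (num h j) = j"
  using assms countable_index by (simp_all add: num_def group_part_def label_part_def)

lemma Inl_labels [simp]: "Inl i \<in> labels" and Inr_labels [simp]: "Inr g \<in> labels \<longleftrightarrow> g \<in> carrier G"
  by (auto simp: labels_def)

lemma num_eqI:
  assumes "\<And>h j. h \<in> carrier G \<Longrightarrow> j \<in> labels \<Longrightarrow> y (num h j) = z (num h j)"
  shows "y = z"
proof
  fix k show "y k = z k"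
    using assms[of "group_part k" "label_part k"] by simp
qed

section \<open>The code map and the shift action\<close>

definition code :: "'a \<Rightarrow> nat \<Rightarrow> bool" where
  "code x k \<longleftrightarrow> T (inv (group_part k)) x \<in> label_set (label_part k)"

definition shift :: "'g \<Rightarrow> (nat \<Rightarrow> bool) \<Rightarrow> nat \<Rightarrow> bool" where
  "shift g y k = y (num (inv g \<otimes> group_part k) (label_part k))"

lemma code_num:
  "h \<in> carrier G \<Longrightarrow> j \<in> labels \<Longrightarrow> code x (num h j) \<longleftrightarrow> T (inv h) x \<in> label_set j"
  by (simp add: code_def parts_num)

lemma shift_num:
  "h \<in> carrier G \<Longrightarrow> j \<in> labels \<Longrightarrow> shift g y (num h j) = y (num (inv g \<otimes> h) j)"
  by (simp add: shift_def parts_num)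

lemma shift_one: "shift \<one> y = y"
  by (rule num_eqI) (simp add: shift_num)

lemma shift_mult:
  "g \<in> carrier G \<Longrightarrow> h \<in> carrier G \<Longrightarrow> shift (g \<otimes> h) y = shift g (shift h y)"
  by (rule num_eqI) (simp add: shift_num inv_mult_group m_assoc)

text \<open>The entry at \<open>h\<close> tests \<open>T (inv h \<otimes> g) x\<close>, and
  \<open>inv h \<otimes> g = inv (inv g \<otimes> h)\<close>. This is why the code uses
  \<open>T (inv h)\<close> and the shift translates by \<open>inv g\<close>.\<close>

lemma code_T: "g \<in> carrier G \<Longrightarrow> x \<in> space M \<Longrightarrow> code (T g x) = shift g (code x)"
  by (rule num_eqI) (simp add: shift_num code_num inv_mult_group T_mult)

text \<open>With \<open>z = T (inv h) x\<close>, the entries of \<open>code x\<close> at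
  \<open>h\<close>, \<open>h \<otimes> g\<close> and \<open>h \<otimes> inv g\<close> tell whether
  \<open>z\<close>, \<open>T (inv g) z\<close> and \<open>T g z\<close> lie in
  \<open>marker g\<close>. The conditions are thus the disjointness and covering properties of the
  markers along an orbit.\<close>

definition model :: "(nat \<Rightarrow> bool) set" where
  "model = {y. \<forall>g\<in>carrier G - {\<one>}. \<forall>h\<in>carrier G.
     \<not> (y (num h (Inr g)) \<and> y (num (h \<otimes> g) (Inr g))) \<and>
     (y (num h (Inr g)) \<or> y (num (h \<otimes> g) (Inr g)) \<or> y (num (h \<otimes> inv g) (Inr g)))}"

text \<open>The shift multiplies on the left and the conditions multiply on the right, so the
  condition at \<open>h\<close> for the shifted sequence is the one at
  \<open>inv g \<otimes> h\<close> for \<open>y\<close>.\<close>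

lemma shift_model:
  assumes g: "g \<in> carrier G" and y: "y \<in> model"
  shows "shift g y \<in> model"
proof -
  have "\<not> (y (num (inv g \<otimes> h) (Inr k)) \<and> y (num (inv g \<otimes> h \<otimes> k) (Inr k))) \<and>
     (y (num (inv g \<otimes> h) (Inr k)) \<or> y (num (inv g \<otimes> h \<otimes> k) (Inr k)) \<or>
      y (num (inv g \<otimes> h \<otimes> inv k) (Inr k)))"
    if "k \<in> carrier G - {\<one>}" "h \<in> carrier G" for k h
    using y that g unfolding model_def by blast
  then show ?thesis
    using g by (simp add: model_def shift_num m_assoc)
qed

lemma code_model:
  assumes x: "x \<in> space M"
  shows "code x \<in> model"
  unfolding model_def
proof (intro CollectI ballI)
  fix g h assume g: "g \<in> carrier G - {\<one>}" and h: "h \<in> carrier G"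
  define z where "z = T (inv h) x"
  have z: "z \<in> space M"
    using T_space h x by (simp add: z_def)
  have "code x (num h (Inr g)) \<longleftrightarrow> z \<in> marker g"
    "code x (num (h \<otimes> g) (Inr g)) \<longleftrightarrow> T (inv g) z \<in> marker g"
    "code x (num (h \<otimes> inv g) (Inr g)) \<longleftrightarrow> T g z \<in> marker g"
    using g h x by (simp_all add: code_num label_set_def z_def inv_mult_group T_mult)
  then show "\<not> (code x (num h (Inr g)) \<and> code x (num (h \<otimes> g) (Inr g))) \<and>
     (code x (num h (Inr g)) \<or> code x (num (h \<otimes> g) (Inr g)) \<or> code x (num (h \<otimes> inv g) (Inr g)))"
    using marker_disjoint[of g z] marker_cover[of g z] g z by blast
qed

text \<open>A fixed point of \<open>g\<close> would have equal entries at \<open>\<one>\<close>, \<open>g\<close> and \<open>inv g\<close> under the label of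
  the marker set of \<open>g\<close>, which the model forbids.\<close>

lemma shift_free:
  assumes g: "g \<in> carrier G" "g \<noteq> \<one>" and y: "y \<in> model"
  shows "shift g y \<noteq> y"
proof
  assume fix_y: "shift g y = y"
  have "shift g y (num h (Inr g)) = y (num (inv g \<otimes> h) (Inr g))" if "h \<in> carrier G" for h
    using that g by (simp add: shift_num)
  from this[of \<one>] this[of g]
  have "y (num \<one> (Inr g)) = y (num (inv g) (Inr g))" "y (num g (Inr g)) = y (num \<one> (Inr g))"
    using g by (simp_all add: fix_y)
  moreover have "\<not> (y (num \<one> (Inr g)) \<and> y (num (\<one> \<otimes> g) (Inr g))) \<and>
     (y (num \<one> (Inr g)) \<or> y (num (\<one> \<otimes> g) (Inr g)) \<or> y (num (\<one> \<otimes> inv g) (Inr g)))"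
    using y g one_closed unfolding model_def by blast
  ultimately show False
    using g by simp
qed

lemma closed_model: "closed model"
proof -
  have coord: "closed ((\<lambda>y. y k) -` X)" for k and X :: "bool set"
    by (intro closed_vimage continuous_on_product_coordinates)
      (simp add: closed_def Topological_Spaces.open_discrete)
  \<comment> \<open>A coordinate and its negation both define closed sets. Each condition is a
    finite combination of these, and intersecting over all \<open>g\<close> and \<open>h\<close>
    preserves closedness.\<close>
  have "closed {y :: nat \<Rightarrow> bool. y k}" "closed {y :: nat \<Rightarrow> bool. \<not> y k}" for k
    using coord[of k "{True}"] coord[of k "{False}"] by (simp_all add: vimage_def)
  then show ?thesis
    unfolding model_def Ball_def de_Morgan_conj
    by (intro closed_Collect_all closed_Collect_imp open_Collect_const closed_Collect_conj
        closed_Collect_disj)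
qed

lemma continuous_on_shift: "continuous_on A (shift g)"
  unfolding shift_def
  by (intro continuous_on_coordinatewise_then_product
      continuous_on_subset[OF continuous_on_product_coordinates subset_UNIV])

section \<open>Measurability, injectivity and range of the code map\<close>

lemma label_set_measurable: "j \<in> labels \<Longrightarrow> label_set j \<in> sets M"
  using encoding_measurable marker_measurable
  by (auto simp: label_set_def labels_def measurable_cantor_iff)

lemma code_measurable: "code \<in> M \<rightarrow>\<^sub>M cantor"
  unfolding measurable_cantor_iff
proof
  fix k
  have "T (inv (group_part k)) \<in> M \<rightarrow>\<^sub>M M"
    by (intro T_measurable) simp
  then have "T (inv (group_part k)) -` label_set (label_part k) \<inter> space M \<in> sets M"
    by (rule measurable_sets) (simp add: label_set_measurable)
  then show "{x \<in> space M. code x k} \<in> sets M"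
    by (simp add: code_def vimage_def Int_def conj_commute)
qed

text \<open>As \<open>T \<one>\<close> is the identity, the \<open>Inl\<close> entries at
  \<open>\<one>\<close> of a code reproduce \<open>\<psi> x\<close>. This gives injectivity of
  \<open>code\<close>, its Borel range and the measurability of its inverse.\<close>

definition decode :: "(nat \<Rightarrow> bool) \<Rightarrow> nat \<times> rat \<Rightarrow> bool" where
  "decode y i = y (num \<one> (Inl i))"

lemma decode_measurable: "decode \<in> cantor \<rightarrow>\<^sub>M cantor"
  by (simp add: measurable_cantor_iff decode_def flip: pred_def)

lemma decode_code: "x \<in> space M \<Longrightarrow> decode (code x) = \<psi> x"
  by (rule ext) (simp add: decode_def code_num label_set_def T_one)

lemma inj_code: "inj_on code (space M)"
  by (rule inj_onI) (metis decode_code inj_encoding inj_onD)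

text \<open>As \<open>decode\<close> recovers \<open>\<psi> x\<close>, and \<open>\<psi> x\<close> determines \<open>x\<close> in a Borel way, the range of
  \<open>code\<close> is the graph of a Borel function over the Borel set \<open>\<psi> ` space M\<close>.\<close>

lemma range_code: "code ` space M \<in> sets cantor"
proof -
  \<comment> \<open>Each coordinate of \<open>code\<close> defines a measurable set, hence is a
    Borel condition \<open>C k\<close> on \<open>\<psi> x\<close>.\<close>
  have "\<exists>C. C \<in> sets cantor \<and> {x \<in> space M. code x k} = \<psi> -` C \<inter> space M" for k
    using code_measurable unfolding measurable_cantor_iff sets_encoding by blast
  then obtain C where C [measurable]: "\<And>k. C k \<in> sets cantor"
    and code_C: "\<And>k. {x \<in> space M. code x k} = \<psi> -` C k \<inter> space M"
    by metis
  note [measurable] = decode_measurable range_encoding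
  have code_iff: "code x k \<longleftrightarrow> \<psi> x \<in> C k" if "x \<in> space M" for x k
    using code_C[of k] that by blast
  have "code ` space M = {y \<in> space cantor. decode y \<in> \<psi> ` space M \<and> (\<forall>k. y k \<longleftrightarrow> decode y \<in> C k)}"
  proof (intro Set.set_eqI iffI)
    fix y assume "y \<in> code ` space M"
    then obtain x where x: "x \<in> space M" and y: "y = code x"
      by blast
    show "y \<in> {y \<in> space cantor. decode y \<in> \<psi> ` space M \<and> (\<forall>k. y k \<longleftrightarrow> decode y \<in> C k)}"
      using x by (simp add: y decode_code code_iff space_cantor)
  next
    fix y assume "y \<in> {y \<in> space cantor. decode y \<in> \<psi> ` space M \<and> (\<forall>k. y k \<longleftrightarrow> decode y \<in> C k)}"
    then obtain x where x: "x \<in> space M" "decode y = \<psi> x" and y: "\<And>k. y k \<longleftrightarrow> decode y \<in> C k"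
      by blast
    have "y = code x"
      by (rule ext) (simp add: y x code_iff)
    then show "y \<in> code ` space M"
      using x by blast
  qed
  also have "\<dots> \<in> sets cantor"
    by measurable
  finally show ?thesis .
qed


section \<open>The model as a topological and measure preserving system\<close>

definition model_shift :: "'g \<Rightarrow> (nat \<Rightarrow> bool) \<Rightarrow> nat \<Rightarrow> bool" where
  "model_shift g = restrict (shift g) model"

definition model_measure :: "(nat \<Rightarrow> bool) measure" where
  "model_measure = distr M (restrict_space borel model) code"

lemma space_model_measure [simp]: "space model_measure = model"
  and sets_model_measure [measurable_cong]: "sets model_measure = sets (restrict_space borel model)"
  by (simp_all add: model_measure_def space_restrict_space)

lemma code_measurable_model: "code \<in> M \<rightarrow>\<^sub>M restrict_space borel model"
  using code_measurable code_model measurable_cong_sets[OF refl sets_cantor_eq_borel]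
  by (intro measurable_restrict_space2) auto

lemma range_code_model: "code ` space M \<in> sets model_measure"
proof -
  have "code ` space M \<in> sets borel"
    using range_code by (simp add: sets_cantor_eq_borel)
  then show ?thesis
    using code_model closed_model by (auto simp: sets_model_measure sets_restrict_space_iff)
qed

lemma group_action_model: "group_action G model model_shift"
  unfolding model_shift_def
  by (rule group_action_restrictI) (simp_all add: is_group shift_model shift_one shift_mult)

lemma homeo_action_model: "homeo_action G (top_of_set model) model_shift"
proof -
  have cont: "continuous_map (top_of_set model) (top_of_set model) (model_shift g)"
    if "g \<in> carrier G" for g
    using that shift_model continuous_on_shift
    by (auto simp: model_shift_def cong: continuous_on_cong)
  have "homeomorphic_map (top_of_set model) (top_of_set model) (model_shift g)"
    if g: "g \<in> carrier G" for g
    unfolding homeomorphic_map_maps homeomorphic_maps_def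
    using g cont by (intro exI[of _ "model_shift (inv g)"])
      (auto simp: model_shift_def shift_model shift_one simp flip: shift_mult)
  then show ?thesis
    using group_action_model by (simp add: homeo_action_def)
qed

lemma model_shift_measurable:
  assumes "g \<in> carrier G"
  shows "model_shift g \<in> model_measure \<rightarrow>\<^sub>M restrict_space borel model"
proof -
  have "shift g \<in> borel \<rightarrow>\<^sub>M borel"
    by (intro borel_measurable_continuous_onI continuous_on_shift)
  then have "shift g \<in> model_measure \<rightarrow>\<^sub>M borel"
    using measurable_restrict_space1 measurable_cong_sets[OF sets_model_measure refl] by blast
  then have "model_shift g \<in> model_measure \<rightarrow>\<^sub>M borel"
    by (subst measurable_cong[where g = "shift g"]) (simp_all add: model_shift_def)
  then show ?thesis
    using assms shift_model by (intro measurable_restrict_space2) (auto simp: model_shift_def)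
qed

lemma prob_space_model: "prob_space model_measure"
  unfolding model_measure_def using prob_space_M code_measurable_model
  by (rule prob_space.prob_space_distr)

text \<open>The measure on the model is the image of \<open>M\<close> under the equivariant map
  \<open>code\<close>, so it inherits invariance from \<open>M\<close>.\<close>

lemma mp_action_model: "mp_action G model_measure model_shift"
  unfolding mp_action_def space_model_measure
proof (intro conjI ballI)
  fix g assume g: "g \<in> carrier G"
  show meas: "model_shift g \<in> model_measure \<rightarrow>\<^sub>M model_measure"
    using model_shift_measurable[OF g] measurable_cong_sets[OF refl sets_model_measure] by blast
  have meas': "model_shift g \<in> restrict_space borel model \<rightarrow>\<^sub>M restrict_space borel model"
    using model_shift_measurable[OF g] measurable_cong_sets[OF sets_model_measure refl] by blast
  have "distr model_measure model_measure (model_shift g) =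
      distr (distr M (restrict_space borel model) code) (restrict_space borel model) (model_shift g)"
    by (rule distr_cong) (simp_all add: model_measure_def)
  also have "\<dots> = distr M (restrict_space borel model) (model_shift g \<circ> code)"
    by (rule distr_distr[OF meas' code_measurable_model])
  also have "\<dots> = distr M (restrict_space borel model) (code \<circ> T g)"
    by (rule distr_cong) (simp_all add: model_shift_def code_model code_T g)
  also have "\<dots> = distr (distr M M (T g)) (restrict_space borel model) code"
    by (rule distr_distr[symmetric, OF code_measurable_model T_measurable[OF g]])
  also have "\<dots> = model_measure"
    by (simp add: T_preserves[OF g] model_measure_def)
  finally show "distr model_measure model_measure (model_shift g) = model_measure" .
qed (rule group_action_model)

lemma topologically_free_model: "topologically_free G (top_of_set model) model_shift"
  by (simp add: topologically_free_def model_shift_def shift_free)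

text \<open>Nothing has to be discarded from \<open>M\<close>, because \<open>code\<close> is
  injective on the whole space. In the model the isomorphism lives on the range of
  \<open>code\<close>, which is Borel, invariant and of measure 1.\<close>

lemma isomorphic_actions_model: "isomorphic_actions G M T model_measure model_shift"
  unfolding isomorphic_actions_def
proof (intro exI conjI ballI)
  let ?Y0 = "code ` space M"
  have M: "restrict_space M (space M) = M"
    by (rule measure_eqI) (auto simp: sets_restrict_space_iff emeasure_restrict_space
      sets.sets_into_space dest: sets.sets_into_space[THEN subsetD])
  have T_image: "T g ` space M = space M" if g: "g \<in> carrier G" for g
  proof
    show "space M \<subseteq> T g ` space M"
    proof
      fix x assume x: "x \<in> space M"
      have "x = T g (T (inv g) x)"
        using g x by (simp add: T_one flip: T_mult)
      then show "x \<in> T g ` space M"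
        using T_space[of "inv g"] g x by blast
    qed
  qed (use T_space g in auto)
  show "space M \<in> sets M" by simp
  show "emeasure M (space M) = 1"
    using prob_space_M by (rule prob_space.emeasure_space_1)
  show "T g ` space M = space M" if "g \<in> carrier G" for g
    using T_image that .
  show "?Y0 \<in> sets model_measure"
    by (rule range_code_model)
  have "code -` ?Y0 \<inter> space M = space M" by blast
  then show "emeasure model_measure ?Y0 = 1"
    using range_code_model code_measurable_model prob_space_M
    by (simp add: model_measure_def emeasure_distr prob_space.emeasure_space_1)
  show "model_shift g ` ?Y0 = ?Y0" if g: "g \<in> carrier G" for g
  proof -
    have "model_shift g ` ?Y0 = code ` (T g ` space M)"
      unfolding image_image by (rule image_cong) (simp_all add: model_shift_def code_model code_T g)
    then show ?thesis
      using T_image[OF g] by simp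
  qed
  show "bij_betw code (space M) ?Y0"
    by (rule inj_on_imp_bij_betw[OF inj_code])
  have "code \<in> M \<rightarrow>\<^sub>M model_measure"
    using code_measurable_model measurable_cong_sets[OF refl sets_model_measure] by blast
  then show code_Y0: "code \<in> restrict_space M (space M) \<rightarrow>\<^sub>M restrict_space model_measure ?Y0"
    unfolding M by (intro measurable_restrict_space2) auto
  show "inv_into (space M) code \<in>
      restrict_space model_measure ?Y0 \<rightarrow>\<^sub>M restrict_space M (space M)"
    unfolding M
  proof (rule measurableI)
    fix B assume "B \<in> sets M"
    then obtain C where C: "C \<in> sets cantor" and B: "B = \<psi> -` C \<inter> space M"
      unfolding sets_encoding by blast
    have "decode -` C \<inter> space cantor \<in> sets cantor"
      using decode_measurable C by (rule measurable_sets)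
    then have "decode -` C \<in> sets borel"
      by (simp add: space_cantor sets_cantor_eq_borel)
    then have "model \<inter> decode -` C \<in> sets model_measure"
      unfolding sets_model_measure sets_restrict_space by blast
    then have "?Y0 \<inter> (model \<inter> decode -` C) \<in> sets (restrict_space model_measure ?Y0)"
      unfolding sets_restrict_space by blast
    moreover have "inv_into (space M) code -` B \<inter> space (restrict_space model_measure ?Y0) =
        ?Y0 \<inter> (model \<inter> decode -` C)"
      using code_model by (auto simp: B space_restrict_space inv_into_f_f[OF inj_code] decode_code)
    ultimately show "inv_into (space M) code -` B \<inter> space (restrict_space model_measure ?Y0)
        \<in> sets (restrict_space model_measure ?Y0)"
      by simp
  qed (auto simp: space_restrict_space inv_into_f_f[OF inj_code])
  show "distr (restrict_space M (space M)) (restrict_space model_measure ?Y0) code =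
      restrict_space model_measure ?Y0"
  proof (rule measure_eqI)
    fix A assume "A \<in> sets (distr (restrict_space M (space M)) (restrict_space model_measure ?Y0) code)"
    then have A: "A \<in> sets (restrict_space model_measure ?Y0)" by simp
    then have A': "A \<subseteq> ?Y0" "A \<in> sets (restrict_space borel model)"
      unfolding sets_model_measure[symmetric]
      using sets_restrict_space_iff[of ?Y0 model_measure A] sets.Int_space_eq2[OF range_code_model]
        range_code_model by simp_all
    have "emeasure (distr (restrict_space M (space M)) (restrict_space model_measure ?Y0) code) A =
        emeasure M (code -` A \<inter> space M)"
      using emeasure_distr[OF code_Y0 A] unfolding M .
    also have "\<dots> = emeasure model_measure A"
      unfolding model_measure_def by (rule emeasure_distr[symmetric, OF code_measurable_model A'(2)])
    also have "\<dots> = emeasure (restrict_space model_measure ?Y0) A"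
      using range_code_model A'(1) sets.Int_space_eq2[OF range_code_model]
      by (simp add: emeasure_restrict_space)
    finally show "emeasure (distr (restrict_space M (space M)) (restrict_space model_measure ?Y0) code) A =
        emeasure (restrict_space model_measure ?Y0) A" .
  qed simp
  show "code (T g x) = model_shift g (code x)" if "g \<in> carrier G" "x \<in> space M" for g x
    using that by (simp add: model_shift_def code_model code_T)
qed

end

section \<open>Reduction to the points with trivial stabilizer\<close>

theorem proposition1:
  fixes G :: "('g, 'b) monoid_scheme"
    and M :: "'a measure"
    and T :: "'g \<Rightarrow> 'a \<Rightarrow> 'a"
  assumes "group G"
    and "countable (carrier G)"
    and "standard_prob_space M"
    and "mp_action G M T"
    and "free_action G M T"
  shows "\<exists>(Y :: (nat \<Rightarrow> bool) topology) S N.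
    compact_space Y \<and> metrizable_space Y \<and> zero_dimensional Y \<and>
    homeo_action G Y S \<and> topologically_free G Y S \<and>
    space N = topspace Y \<and> sets N = sets (borel_of Y) \<and> prob_space N \<and> mp_action G N S \<and>
    isomorphic_actions G M T N S"
proof -
  interpret group G by fact
  interpret prob_space M
    using assms(3) by (simp add: standard_prob_space_def)
  interpret action: group_action G "space M" T
    using assms(4) by (simp add: mp_action_def)
  have T_meas: "T g \<in> M \<rightarrow>\<^sub>M M" and T_distr: "distr M M (T g) = M" if "g \<in> carrier G" for g
    using assms(4) that by (simp_all add: mp_action_def)
  have T_one: "T \<one>\<^bsub>G\<^esub> x = x" if "x \<in> space M" for x
    using that by (simp flip: action.id_eq_one)
  obtain \<psi> :: "'a \<Rightarrow> nat \<times> rat \<Rightarrow> bool" where \<psi>: "borel_encoding M \<psi>"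
    using assms(3) standard_borel_encoding not_empty unfolding standard_prob_space_def by metis
  define X where "X = {x \<in> space M. \<forall>g\<in>carrier G - {\<one>\<^bsub>G\<^esub>}. T g x \<noteq> x}"
  \<comment> \<open>Countability of \<open>G\<close> keeps the union of the fixed-point sets
    null.\<close>
  have null: "(\<Union>g\<in>carrier G - {\<one>\<^bsub>G\<^esub>}. {x \<in> space M. T g x = x}) \<in> null_sets M"
    using assms(2,5) unfolding free_action_def by (intro null_sets_UN') auto
  have X_eq: "X = space M - (\<Union>g\<in>carrier G - {\<one>\<^bsub>G\<^esub>}. {x \<in> space M. T g x = x})"
    by (auto simp: X_def)
  have X: "X \<in> sets M"
    using null unfolding X_eq by auto
  have X_1: "emeasure M X = 1"
    using null unfolding X_eq by (simp add: emeasure_Diff_null_set emeasure_space_1)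
  have XM: "X \<subseteq> space M" by (auto simp: X_def)
  have space_X: "space (restrict_space M X) = X"
    using XM by (auto simp: space_restrict_space)
  have T_X: "T h x \<in> X" if h: "h \<in> carrier G" and x: "x \<in> X" for h x
    unfolding X_def
  proof (intro CollectI conjI ballI notI)
    have xM: "x \<in> space M" using x XM by blast
    then show "T h x \<in> space M"
      using T_meas[OF h] by (rule measurable_space[rotated])
    fix g assume g: "g \<in> carrier G - {\<one>\<^bsub>G\<^esub>}" and fixed: "T g (T h x) = T h x"
    \<comment> \<open>Stabilizers along an orbit are conjugate: if \<open>g\<close> fixes
      \<open>T h x\<close>, this conjugate fixes \<open>x\<close> and so is trivial, which forces
      \<open>g\<close> to be trivial.\<close>
    define k where "k = inv\<^bsub>G\<^esub> h \<otimes>\<^bsub>G\<^esub> (g \<otimes>\<^bsub>G\<^esub> h)"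
    have k: "k \<in> carrier G"
      using g h by (simp add: k_def)
    have "T k x = T (inv\<^bsub>G\<^esub> h) (T g (T h x))"
      using g h xM by (simp add: k_def action.composition_rule)
    also have "\<dots> = T (inv\<^bsub>G\<^esub> h \<otimes>\<^bsub>G\<^esub> h) x"
      unfolding fixed using h xM by (intro action.composition_rule[symmetric]) auto
    also have "\<dots> = x"
      using h xM T_one by simp
    finally have "k = \<one>\<^bsub>G\<^esub>"
      using k x by (auto simp: X_def)
    moreover have "g \<otimes>\<^bsub>G\<^esub> h = h \<otimes>\<^bsub>G\<^esub> k"
      using g h by (simp add: k_def flip: m_assoc)
    ultimately have "g \<otimes>\<^bsub>G\<^esub> h = h"
      using h by simp
    then show False
      using g h by simp
  qed
  interpret free_borel_action G "restrict_space M X" T \<psi>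
  proof (intro free_borel_action.intro free_borel_action_axioms.intro)
    show "group G" "countable (carrier G)" by fact+
    show "prob_space (restrict_space M X)"
      using X X_1 by (intro prob_space_restrict_space) auto
    show "borel_encoding (restrict_space M X) \<psi>"
      using \<psi> X by (rule borel_encoding_restrict_space)
    fix g assume g: "g \<in> carrier G"
    show meas: "T g \<in> restrict_space M X \<rightarrow>\<^sub>M restrict_space M X"
      using T_X g
      by (intro measurable_restrict_space2 measurable_restrict_space1 T_meas) (auto simp: space_X)
    show "T (g \<otimes>\<^bsub>G\<^esub> h) x = T g (T h x)"
      if "h \<in> carrier G" "x \<in> space (restrict_space M X)" for h x
      using that g XM unfolding space_X by (intro action.composition_rule) auto
    show "T g x \<noteq> x" if "g \<noteq> \<one>\<^bsub>G\<^esub>" "x \<in> space (restrict_space M X)" for x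
      using that g unfolding space_X by (simp add: X_def)
    show "distr (restrict_space M X) (restrict_space M X) (T g) = restrict_space M X"
    proof (rule measure_eqI)
      fix A assume "A \<in> sets (distr (restrict_space M X) (restrict_space M X) (T g))"
      then have A: "A \<in> sets (restrict_space M X)" by simp
      then have A': "A \<in> sets M" "A \<subseteq> X"
        using X by (simp_all add: sets_restrict_space_iff)
      \<comment> \<open>By invariance of \<open>X\<close> under \<open>inv g\<close>, no point
        outside \<open>X\<close> is mapped into \<open>A\<close>, so invariance of \<open>M\<close>
        passes to the restriction.\<close>
      have "T g -` A \<inter> space M \<subseteq> X"
      proof
        fix x assume "x \<in> T g -` A \<inter> space M"
        then have x: "x \<in> space M" "T g x \<in> X"
          using A'(2) by auto
        have "T (inv\<^bsub>G\<^esub> g) (T g x) = x"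
          using g x T_one by (simp flip: action.composition_rule)
        then show "x \<in> X"
          using T_X[of "inv\<^bsub>G\<^esub> g"] g x(2) by fastforce
      qed
      then have "T g -` A \<inter> X = T g -` A \<inter> space M"
        using XM by blast
      then have "emeasure (distr (restrict_space M X) (restrict_space M X) (T g)) A =
          emeasure (restrict_space M X) (T g -` A \<inter> space M)"
        using emeasure_distr[OF meas A] by (simp add: space_X)
      also have "\<dots> = emeasure M (T g -` A \<inter> space M)"
        using X \<open>T g -` A \<inter> space M \<subseteq> X\<close> by (intro emeasure_restrict_space) simp_all
      also have "\<dots> = emeasure (distr M M (T g)) A"
        by (rule emeasure_distr[symmetric, OF T_meas[OF g] A'(1)])
      also have "\<dots> = emeasure (restrict_space M X) A"
        using X A' by (simp add: T_distr[OF g] emeasure_restrict_space)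
      finally show "emeasure (distr (restrict_space M X) (restrict_space M X) (T g)) A =
          emeasure (restrict_space M X) A" .
    qed simp
  qed (use T_one XM in \<open>auto simp: space_X\<close>)
  have "compact model"
    using closed_Int_compact[OF closed_model compact_cantor] by simp
  then have "compact_space (top_of_set model)"
    by (simp add: compact_space_subtopology)
  moreover have "metrizable_space (top_of_set model)"
    by (intro metrizable_space_subtopology metrizable_cantor)
  moreover have "sets model_measure = sets (borel_of (top_of_set model))"
    by (simp add: sets_model_measure sets_borel_of_top_of_set)
  ultimately show ?thesis
    using zero_dimensional_top_of_set homeo_action_model topologically_free_model
      prob_space_model mp_action_model
      isomorphic_actions_restrict_space[OF isomorphic_actions_model X]
    by (intro exI[of _ "top_of_set model"] exI[of _ model_shift] exI[of _ model_measure]) simp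
qed

end
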